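(* Let $(R,\mathfrak{m})$ be a finite commutative local ring with identity, with $|\mathfrak{m}|=m$ and residue field $R/\mathfrak{m}\simeq\mathbb{F}_q$. If $k\in\mathbb{N}$ satisfies $\gcd(k,|R|)=1$, then $$\mathcal{G}_R(k)\simeq \mathcal{G}_{\mathbb{F}_q}(k)^{(m)}.$$ Furthermore, if $R$ has odd characteristic then $$\mathcal{G}_R(k)\simeq\begin{cases}G_{\mathbb{F}_q}(k)^{(m)}&\text{if }v_2(k)<v_2(q-1),\\ G_{\mathbb{F}_q}\big(\tfrac{k}{2^N}\big)^{(m)}&\text{if }v_2(k)\ge v_2(q-1),\end{cases}$$ where $N=v_2(k)-v_2(q-1)+1$. In particular (for $R$ of odd characteristic), with $k'=\gcd(k,q-1)$, the graph $\mathcal{G}_R(k)$ is $\frac{m(q-1)}{k'}$-regular if $v_2(k)<v_2(q-1)$ and $\frac{2m(q-1)}{k'}$-regular if $v_2(k)\ge v_2(q-1)$.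
   Context: For a commutative ring $R$ with identity and a positive integer $k$, $R^*$ is the group of units, $U_{R,k}=\{x^k:x\in R^*\}$ and $T_{R,k}=U_{R,k}\cup(-U_{R,k})$. For an abelian group $A$ and $S\subseteq A$ with $0\notin S$, $X(A,S)$ denotes the Cayley digraph with vertex set $A$ and an arc from $v$ to $w$ iff $w-v\in S$; it is undirected if $S=-S$. Define $G_R(k)=X(R,U_{R,k})$ and $\mathcal{G}_R(k)=X(R,T_{R,k})$. For a graph $\Gamma$ and $m\in\mathbb{N}$, the balanced blow-up $\Gamma^{(m)}$ is obtained by replacing each vertex $x$ by a set $V_x$ of $m$ independent vertices and each edge $\{x,y\}$ by a complete bipartite graph $K_{m,m}$ with parts $V_x,V_y$. $\simeq$ denotes graph isomorphism, and $v_2(n)$ is the $2$-adic valuation of $n$. *)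

theory Defs
  imports
    "HOL-Algebra.Algebra"
    "HOL-Computational_Algebra.Factorial_Ring"
    "Graph_Theory.Pair_Digraph"
    "Graph_Theory.Digraph_Isomorphism"
begin

locale local_ring = cring R + maximalideal M R for M and R (structure) +
  assumes maximalideal_unique: "maximalideal J R \<Longrightarrow> J = M"

(* The order of 1 in the additive group; group.ord is 0 for elements of infinite order. *)
definition ring_characteristic :: "('a, 'm) ring_scheme \<Rightarrow> nat" where
  "ring_characteristic R = group.ord (add_monoid R) \<one>\<^bsub>R\<^esub>"

definition unit_powers :: "('a, 'm) ring_scheme \<Rightarrow> nat \<Rightarrow> 'a set" where
  "unit_powers R k = {x [^]\<^bsub>R\<^esub> k | x. x \<in> Units R}"

definition pm_unit_powers :: "('a, 'm) ring_scheme \<Rightarrow> nat \<Rightarrow> 'a set" where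
  "pm_unit_powers R k = unit_powers R k \<union> {\<ominus>\<^bsub>R\<^esub> u | u. u \<in> unit_powers R k}"

(* An undirected graph is represented by the digraph having both arcs (v, w) and (w, v) for
   each edge {v, w}; for S = -S the Cayley digraph is of this form. Only the additive
   structure of A is used. *)
definition cayley_digraph :: "('a, 'm) ring_scheme \<Rightarrow> 'a set \<Rightarrow> 'a pair_pre_digraph" where
  "cayley_digraph A S =
     \<lparr>pverts = carrier A,
      parcs = {(v, w). v \<in> carrier A \<and> w \<in> carrier A \<and> w \<ominus>\<^bsub>A\<^esub> v \<in> S}\<rparr>"

(* G_R(k) *)
definition unit_power_digraph :: "('a, 'm) ring_scheme \<Rightarrow> nat \<Rightarrow> 'a pair_pre_digraph" where
  "unit_power_digraph R k = cayley_digraph R (unit_powers R k)"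

(* The calligraphic G_R(k), with connection set T_{R,k} *)
definition pm_unit_power_graph :: "('a, 'm) ring_scheme \<Rightarrow> nat \<Rightarrow> 'a pair_pre_digraph" where
  "pm_unit_power_graph R k = cayley_digraph R (pm_unit_powers R k)"

(* V_x is {x} \<times> {..<m}. For a loop-free symmetric digraph G (i.e. a graph) this is the
   balanced blow-up of the graph: the V_x are independent, and each edge {x, y} becomes a
   complete bipartite graph between V_x and V_y. *)
definition balanced_blow_up :: "'a pair_pre_digraph \<Rightarrow> nat \<Rightarrow> ('a \<times> nat) pair_pre_digraph" where
  "balanced_blow_up G m =
     \<lparr>pverts = pverts G \<times> {..<m},
      parcs = {((x, i), (y, j)). (x, y) \<in> parcs G \<and> i < m \<and> j < m}\<rparr>"

definition regular_digraph :: "('a, 'b) pre_digraph \<Rightarrow> nat \<Rightarrow> bool" where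
  "regular_digraph G d \<longleftrightarrow> (\<forall>v\<in>verts G. out_degree G v = d \<and> in_degree G v = d)"

end

theory Submission
  imports Defs
begin

text \<open>
  Choose a surjective ring homomorphism \<open>h: R \<rightarrow> F\<close> with kernel \<open>M\<close>. The theorem rests on the fact
  that \<open>x \<in> R\<close> is the \<open>k\<close>-th power of a unit if and only if \<open>h x\<close> is
  (\<open>unit_powers_iff\<close>): the elements of \<open>R\<close> over \<open>1\<close> form a group of order \<open>card M\<close>, which divides the order
  of \<open>R\<close> and is therefore prime to \<open>k\<close>, so every one of them is a \<open>k\<close>-th power and the correction from
  \<open>h x = h (y ^ k)\<close> to \<open>x = z ^ k\<close> is possible. Hence the connection set in \<open>R\<close> is the full preimage of
  the connection set in \<open>F\<close>. Adjacency of \<open>v\<close> and \<open>w\<close> then depends only on \<open>h v\<close> and \<open>h w\<close>, and since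
  all fibres of \<open>h\<close> have \<open>card M\<close> elements, numbering each fibre turns the Cayley digraph over \<open>R\<close> into a
  blow-up of the one over \<open>F\<close> (\<open>digraph_iso_balanced_blow_upI\<close>).

  The remaining claims concern \<open>F\<close> alone, in which \<open>1 + 1 \<noteq> 0\<close> when \<open>R\<close> has odd characteristic, so that
  \<open>-1\<close> has order 2 in the unit group and \<open>q - 1\<close> is even. Put \<open>n = q - 1\<close> and \<open>d = n / gcd(k, n)\<close>. The unit group is
  cyclic, so the \<open>k\<close>-th powers are exactly the \<open>d\<close> solutions of \<open>x ^ d = 1\<close>
  (\<open>unit_powers_finite_field\<close>). If \<open>v2 k < v2 n\<close> then \<open>d\<close> is even, and this set is closed under
  negation. Otherwise \<open>d\<close> is odd; adjoining the negatives adds the solutions of \<open>x ^ d = -1\<close>, which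
  gives the solutions of \<open>x ^ (2 * d) = 1\<close>, and these are the \<open>(k / 2 ^ N)\<close>-th powers, because
  dividing \<open>k\<close> by \<open>2 ^ N\<close> lowers its 2-adic valuation to \<open>v2 n - 1\<close> and so halves the gcd with \<open>n\<close>.
  The degree of regularity is the size of the connection set, \<open>card M\<close> times \<open>d\<close> or \<open>2 * d\<close>.
\<close>

section \<open>Cayley digraphs and blow-ups\<close>

text \<open>
  A bijection of every fibre of \<open>f\<close> with \<open>{..<m}\<close> supplies the second coordinate of the isomorphism;
  any choice works, because adjacency in \<open>G\<close> ignores the position within the fibre.
\<close>

lemma digraph_iso_balanced_blow_upI:
  assumes fin: "finite (pverts G)"
    and f: "f ` pverts G \<subseteq> pverts H"
    and fibre: "\<And>y. y \<in> pverts H \<Longrightarrow> card {x \<in> pverts G. f x = y} = m"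
    and arcs_G: "\<And>v w. (v, w) \<in> parcs G \<longleftrightarrow> v \<in> pverts G \<and> w \<in> pverts G \<and> (f v, f w) \<in> parcs H"
    and arcs_H: "parcs H \<subseteq> pverts H \<times> pverts H"
  shows "digraph_iso (with_proj G) (with_proj (balanced_blow_up H m))"
proof -
  have "\<exists>e. bij_betw e {x \<in> pverts G. f x = y} {..<m}" if "y \<in> pverts H" for y
    using ex_bij_betw_finite_nat[of "{x \<in> pverts G. f x = y}"] fin fibre[OF that]
    by (simp add: atLeast0LessThan)
  then obtain e where e: "\<And>y. y \<in> pverts H \<Longrightarrow> bij_betw (e y) {x \<in> pverts G. f x = y} {..<m}"
    by metis
  define \<phi> where "\<phi> x = (f x, e (f x) x)" for x
  have inj: "inj_on \<phi> (pverts G)"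
  proof (rule inj_onI)
    fix x y assume xy: "x \<in> pverts G" "y \<in> pverts G" "\<phi> x = \<phi> y"
    then have "f x = f y" "e (f x) x = e (f x) y"
      by (auto simp: \<phi>_def)
    then show "x = y"
      using xy f inj_onD[OF bij_betw_imp_inj_on[OF e[of "f x"]], of x y] by auto
  qed
  have surj: "\<exists>x \<in> pverts G. f x = y \<and> \<phi> x = (y, i)" if "y \<in> pverts H" "i < m" for y i
  proof -
    have "i \<in> e y ` {x \<in> pverts G. f x = y}"
      using bij_betw_imp_surj_on[OF e[OF that(1)]] that(2) by simp
    then show ?thesis
      by (auto simp: \<phi>_def)
  qed
  have mem: "e (f x) x < m" if "x \<in> pverts G" for x
    using bij_betw_imp_surj_on[OF e[of "f x"]] f that by auto
  define iso where "iso = \<lparr>iso_verts = \<phi>, iso_arcs = map_prod \<phi> \<phi>, iso_head = snd, iso_tail = fst\<rparr>"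
  have sub: "parcs G \<subseteq> pverts G \<times> pverts G"
    using arcs_G by auto
  have wf: "wf_digraph (with_proj G)"
    using sub by unfold_locales auto
  have "inj_on (map_prod \<phi> \<phi>) (pverts G \<times> pverts G)"
    using inj by (auto simp: inj_on_def)
  then have iso: "pre_digraph.digraph_isomorphism (with_proj G) iso"
    using wf inj sub inj_on_subset
    unfolding pre_digraph.digraph_isomorphism_def iso_def by auto
  have verts: "\<phi> ` pverts G = pverts H \<times> {..<m}"
  proof
    show "\<phi> ` pverts G \<subseteq> pverts H \<times> {..<m}"
      using f mem by (auto simp: \<phi>_def)
    show "pverts H \<times> {..<m} \<subseteq> \<phi> ` pverts G"
      using surj by (force simp: image_iff)
  qed
  have arcs: "map_prod \<phi> \<phi> ` parcs G = parcs (balanced_blow_up H m)"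
  proof
    show "map_prod \<phi> \<phi> ` parcs G \<subseteq> parcs (balanced_blow_up H m)"
      using mem arcs_G by (auto simp: \<phi>_def balanced_blow_up_def)
    show "parcs (balanced_blow_up H m) \<subseteq> map_prod \<phi> \<phi> ` parcs G"
    proof
      fix a assume "a \<in> parcs (balanced_blow_up H m)"
      then obtain y i z j where a: "a = ((y, i), (z, j))" "(y, z) \<in> parcs H" "i < m" "j < m"
        by (auto simp: balanced_blow_up_def)
      then obtain v w where "v \<in> pverts G" "f v = y" "\<phi> v = (y, i)"
        "w \<in> pverts G" "f w = z" "\<phi> w = (z, j)"
        using surj[of y i] surj[of z j] arcs_H by blast
      then show "a \<in> map_prod \<phi> \<phi> ` parcs G"
        using a arcs_G by (intro image_eqI[of _ _ "(v, w)"]) auto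
    qed
  qed
  have "with_proj (balanced_blow_up H m) = app_iso iso (with_proj G)"
    using verts arcs
    by (intro pre_digraph.equality) (auto simp: iso_def balanced_blow_up_def)
  then show ?thesis
    using iso unfolding digraph_iso_def by blast
qed

text \<open>
  Out-neighbours of \<open>v\<close> are its translates \<open>v + s\<close> and in-neighbours the translates \<open>v - s\<close>, one for
  each \<open>s \<in> S\<close>.
\<close>

lemma (in ring) regular_cayley_digraph:
  assumes S: "S \<subseteq> carrier R"
  shows "regular_digraph (with_proj (cayley_digraph R S)) (card S)"
proof -
  let ?G = "with_proj (cayley_digraph R S)"
  have "out_degree ?G v = card S \<and> in_degree ?G v = card S" if v: "v \<in> carrier R" for v
  proof
    have "out_arcs ?G v = (\<lambda>s. (v, v \<oplus> s)) ` S"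
    proof
      show "out_arcs ?G v \<subseteq> (\<lambda>s. (v, v \<oplus> s)) ` S"
      proof
        fix a assume "a \<in> out_arcs ?G v"
        then obtain w where w: "a = (v, w)" "w \<in> carrier R" "w \<ominus> v \<in> S"
          by (auto simp: out_arcs_def cayley_digraph_def)
        moreover have "w = v \<oplus> (w \<ominus> v)"
          using v w by algebra
        ultimately show "a \<in> (\<lambda>s. (v, v \<oplus> s)) ` S"
          by blast
      qed
      have "v \<oplus> s \<ominus> v = s" if "s \<in> S" for s
        using v that S by (auto simp: subset_iff) algebra
      then show "(\<lambda>s. (v, v \<oplus> s)) ` S \<subseteq> out_arcs ?G v"
        using v S by (auto simp: out_arcs_def cayley_digraph_def)
    qed
    moreover have "inj_on (\<lambda>s. (v, v \<oplus> s)) S"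
      using v S by (auto simp: inj_on_def subset_iff)
    ultimately show "out_degree ?G v = card S"
      by (simp add: out_degree_def card_image)
    have "in_arcs ?G v = (\<lambda>s. (v \<ominus> s, v)) ` S"
    proof
      show "in_arcs ?G v \<subseteq> (\<lambda>s. (v \<ominus> s, v)) ` S"
      proof
        fix a assume "a \<in> in_arcs ?G v"
        then obtain w where w: "a = (w, v)" "w \<in> carrier R" "v \<ominus> w \<in> S"
          by (auto simp: in_arcs_def cayley_digraph_def)
        moreover have "w = v \<ominus> (v \<ominus> w)"
          using v w by algebra
        ultimately show "a \<in> (\<lambda>s. (v \<ominus> s, v)) ` S"
          by blast
      qed
      have "v \<ominus> (v \<ominus> s) = s" if "s \<in> S" for s
        using v that S by (auto simp: subset_iff) algebra
      then show "(\<lambda>s. (v \<ominus> s, v)) ` S \<subseteq> in_arcs ?G v"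
        using v S by (auto simp: in_arcs_def cayley_digraph_def)
    qed
    moreover have "inj_on (\<lambda>s. (v \<ominus> s, v)) S"
    proof (rule inj_onI)
      fix s t assume st: "s \<in> S" "t \<in> S" "(v \<ominus> s, v) = (v \<ominus> t, v)"
      then have "s \<in> carrier R" "t \<in> carrier R" "v \<ominus> s = v \<ominus> t"
        using S by auto
      then have "\<ominus> s = \<ominus> t"
        using v by (simp add: a_minus_def)
      with \<open>s \<in> carrier R\<close> \<open>t \<in> carrier R\<close> show "s = t"
        by (metis minus_minus)
    qed
    ultimately show "in_degree ?G v = card S"
      by (simp add: in_degree_def card_image)
  qed
  then show ?thesis
    by (simp add: regular_digraph_def cayley_digraph_def)
qed

section \<open>Powers in a finite cyclic group\<close>

text \<open>
  For a power \<open>g ^ i\<close> of the generator, both conditions say that \<open>gcd k n\<close> divides \<open>i\<close>. The count is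
  the order of \<open>g ^ k\<close>, which generates the subgroup of \<open>k\<close>-th powers.
\<close>

lemma (in group) powers_in_finite_cyclic_group:
  assumes fin: "finite (carrier G)"
    and g: "g \<in> carrier G" "carrier G = {g [^] i | i::nat. i \<in> UNIV}"
    and k: "k > 0"
  defines "d \<equiv> order G div gcd k (order G)"
  shows "{x [^] k | x. x \<in> carrier G} = {x \<in> carrier G. x [^] d = \<one>}"
    and "card {x [^] k | x. x \<in> carrier G} = d"
proof -
  let ?U = "{x [^] k | x. x \<in> carrier G}"
  define n where "n = order G"
  define c where "c = gcd k n"
  have "n > 0"
    using fin by (simp add: n_def order_gt_0_iff_finite)
  have dc: "n = d * c" "d > 0" "c > 0"
    using \<open>n > 0\<close> k by (auto simp: d_def c_def n_def [symmetric] div_greater_zero_iff gcd_le2_nat)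
  have gen: "generate G {g} = carrier G"
    using generate_pow_on_finite_carrier[OF fin g(1)] g(2) by simp
  have ord: "ord g = n"
    using generate_pow_card[OF g(1)] gen by (simp add: n_def order_def)
  show "?U = {x \<in> carrier G. x [^] d = \<one>}"
  proof (intro equalityI subsetI)
    fix x assume "x \<in> ?U"
    then obtain y where y: "y \<in> carrier G" "x = y [^] k"
      by blast
    have "n dvd k * d"
      using dc(1) mult_dvd_mono[of c k d d] by (simp add: c_def mult.commute)
    then have "y [^] (k * d) = \<one>"
      by (metis y(1) n_def nat_pow_pow nat_pow_one pow_order_eq_1 dvdE)
    then show "x \<in> {x \<in> carrier G. x [^] d = \<one>}"
      using y by (simp add: nat_pow_pow)
  next
    fix x assume x: "x \<in> {x \<in> carrier G. x [^] d = \<one>}"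
    then obtain i :: nat where i: "x = g [^] i"
      using g(2) by blast
    have "g [^] (i * d) = \<one>"
      using x i g(1) by (simp add: nat_pow_pow)
    then have "n dvd i * d"
      using pow_eq_id[OF g(1)] ord by simp
    then obtain j where j: "i = c * j"
      using dc by (auto elim!: dvdE)
    \<comment> \<open>Modulo \<open>n\<close>, the multiple \<open>i = c * j\<close> of the gcd is the multiple \<open>k * (a * j)\<close> of \<open>k\<close>.\<close>
    obtain a b where ab: "k * a = n * b + c"
      using bezout_nat[of k n] k by (auto simp: c_def)
    have "a * j * k = (n * b + c) * j"
      unfolding ab[symmetric] by (simp add: mult_ac)
    then have "(g [^] (a * j)) [^] k = g [^] ((n * b + c) * j)"
      using g(1) by (simp only: nat_pow_pow)
    also have "\<dots> = g [^] (n * (b * j)) \<otimes> g [^] i"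
      using g(1) j by (simp add: nat_pow_mult algebra_simps)
    also have "g [^] (n * (b * j)) = \<one>"
      using pow_eq_id[OF g(1)] ord by simp
    finally have "x = (g [^] (a * j)) [^] k"
      using g(1) i by simp
    then show "x \<in> ?U"
      using g(1) by blast
  qed
  have "?U = {(g [^] k) [^] i | i::nat. i \<in> UNIV}"
  proof (intro equalityI subsetI)
    fix x assume "x \<in> ?U"
    then obtain y where y: "y \<in> carrier G" "x = y [^] k"
      by blast
    from y(1) obtain i :: nat where "y = g [^] i"
      unfolding g(2) by blast
    with y(2) have "x = (g [^] k) [^] i"
      using g(1) by (simp add: nat_pow_pow mult.commute)
    then show "x \<in> {(g [^] k) [^] i | i::nat. i \<in> UNIV}"
      by blast
  next
    fix x assume "x \<in> {(g [^] k) [^] i | i::nat. i \<in> UNIV}"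
    then obtain i :: nat where "x = (g [^] k) [^] i"
      by blast
    then have "x = (g [^] i) [^] k"
      using g(1) by (simp add: nat_pow_pow mult.commute)
    then show "x \<in> ?U"
      using g(1) by blast
  qed
  also have "\<dots> = generate G {g [^] k}"
    using generate_pow_on_finite_carrier[OF fin] g(1) by simp
  finally show "card ?U = d"
    using generate_pow_card[of "g [^] k"] ord_pow_gen[OF g(1), of k] g(1) k ord
    by (simp add: d_def n_def gcd.commute)
qed

section \<open>Powers in a finite field\<close>

lemma (in ring) mem_pm_unit_powers_iff:
  assumes x: "x \<in> carrier R"
  shows "x \<in> pm_unit_powers R k \<longleftrightarrow> x \<in> unit_powers R k \<or> \<ominus> x \<in> unit_powers R k"
proof -
  have sub: "unit_powers R k \<subseteq> carrier R"
    by (auto simp: unit_powers_def)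
  have "(\<exists>u. x = \<ominus> u \<and> u \<in> unit_powers R k) \<longleftrightarrow> \<ominus> x \<in> unit_powers R k"
    using sub x by (metis minus_minus subsetD)
  then show ?thesis
    by (simp add: pm_unit_powers_def)
qed

lemma (in field) order_units_of:
  "finite (carrier R) \<Longrightarrow> order (units_of R) = order R - 1"
  using order_mult_of by (simp add: mult_of_is_Units)

lemma (in field) units_of_finite_field_generator:
  assumes "finite (carrier R)"
  shows "\<exists>g \<in> carrier (units_of R).
    carrier (units_of R) = {g [^]\<^bsub>units_of R\<^esub> i | i::nat. i \<in> UNIV}"
proof -
  obtain g where "g \<in> Units R" "Units R = {g [^] i | i::nat. i \<in> UNIV}"
    using finite_field_mult_group_has_gen[OF assms]
    by (auto simp: mult_of_is_Units units_of_carrier)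
  then show ?thesis
    by (auto simp: units_of_carrier units_of_pow)
qed

lemma (in field) unit_powers_finite_field:
  assumes fin: "finite (carrier R)" and k: "k > 0"
  defines "d \<equiv> (order R - 1) div gcd k (order R - 1)"
  shows "unit_powers R k = {x \<in> Units R. x [^] d = \<one>}"
    and "card (unit_powers R k) = d"
proof -
  interpret U: group "units_of R"
    by (rule units_group)
  obtain g where g: "g \<in> carrier (units_of R)"
      "carrier (units_of R) = {g [^]\<^bsub>units_of R\<^esub> i | i::nat. i \<in> UNIV}"
    using units_of_finite_field_generator[OF fin] by blast
  have eq: "unit_powers R k = {x [^]\<^bsub>units_of R\<^esub> k | x. x \<in> carrier (units_of R)}"
    unfolding unit_powers_def units_of_carrier using units_of_pow by metis
  have fin_U: "finite (carrier (units_of R))"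
    using fin by (simp add: units_of_carrier field_Units)
  note * = U.powers_in_finite_cyclic_group[OF fin_U g k,
      folded eq, unfolded order_units_of[OF fin], folded d_def]
  show "unit_powers R k = {x \<in> Units R. x [^] d = \<one>}"
    unfolding *(1) by (auto simp: units_of_carrier units_of_pow units_of_one)
  show "card (unit_powers R k) = d"
    by (rule *(2))
qed

lemma (in cring) minus_pow_even:
  assumes "x \<in> carrier R" "even d"
  shows "(\<ominus> x) [^] d = x [^] (d::nat)"
proof -
  obtain e where e: "d = 2 * e"
    using assms(2) by blast
  have "(\<ominus> x) [^] (2::nat) = x [^] (2::nat)"
    using assms(1) by (simp add: numeral_2_eq_2 l_minus r_minus)
  then show ?thesis
    using assms(1) by (simp add: e flip: nat_pow_pow)
qed

lemma (in field) minus_Units: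
  "x \<in> Units R \<Longrightarrow> \<ominus> x \<in> Units R"
  by (simp add: field_Units add.inv_eq_1_iff)

lemma (in field) pm_unit_powers_eq_if_even:
  assumes fin: "finite (carrier R)" and k: "k > 0"
    and even: "even ((order R - 1) div gcd k (order R - 1))"
  shows "pm_unit_powers R k = unit_powers R k"
  using minus_pow_even[OF _ even] minus_Units
  by (auto simp: pm_unit_powers_def unit_powers_finite_field[OF fin k])

text \<open>
  If \<open>x ^ (2 * d) = 1\<close> then \<open>x ^ d\<close> is a square root of \<open>1\<close> in a field, so it is \<open>1\<close> or \<open>-1\<close>; in the
  second case \<open>(- x) ^ d = 1\<close> since \<open>d\<close> is odd.
\<close>

lemma (in field) pm_unit_powers_eq_if_odd:
  assumes fin: "finite (carrier R)" and k: "k > 0" and l: "l > 0"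
    and odd: "odd ((order R - 1) div gcd k (order R - 1))"
    and twice: "(order R - 1) div gcd l (order R - 1) = 2 * ((order R - 1) div gcd k (order R - 1))"
  shows "pm_unit_powers R k = unit_powers R l"
proof -
  define d where "d = (order R - 1) div gcd k (order R - 1)"
  have Uk: "unit_powers R k = {x \<in> Units R. x [^] d = \<one>}"
    using unit_powers_finite_field[OF fin k] by (simp add: d_def)
  have Ul: "unit_powers R l = {x \<in> Units R. x [^] (2 * d) = \<one>}"
    using unit_powers_finite_field[OF fin l] twice by (simp add: d_def)
  have sub: "unit_powers R k \<subseteq> unit_powers R l"
    by (auto simp: Uk Ul mult.commute[of 2] simp flip: nat_pow_pow)
  have neg: "\<ominus> x \<in> unit_powers R l" if "x \<in> unit_powers R l" for x
    using that minus_Units minus_pow_even[of x "2 * d"] by (auto simp: Ul)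
  have "x \<in> pm_unit_powers R k" if "x \<in> unit_powers R l" for x
  proof -
    have x: "x \<in> Units R" "x \<in> carrier R" and x2d: "x [^] (d * 2) = \<one>"
      using that by (auto simp: Ul mult.commute)
    have "(x [^] d) \<otimes> (x [^] d) = \<one>"
      using x2d x(2) by (simp add: nat_pow_mult mult_2_right)
    then have "x [^] d = \<one> \<or> x [^] d = \<ominus> \<one>"
      using square_eq_one[of "x [^] d"] x(2) by simp
    then show ?thesis
    proof
      assume "x [^] d = \<one>"
      then show ?thesis
        using x by (simp add: pm_unit_powers_def Uk)
    next
      assume eq: "x [^] d = \<ominus> \<one>"
      obtain e where e: "d = Suc (2 * e)"
        using odd by (auto simp: d_def elim: oddE)
      have "(\<ominus> x) [^] d = \<ominus> (x [^] d)"
        using x(2) minus_pow_even[OF x(2), of "2 * e"] by (simp add: e r_minus)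
      also have "\<dots> = \<one>"
        using eq by simp
      finally have "\<ominus> x \<in> unit_powers R k"
        using minus_Units x by (simp add: Uk)
      moreover have "x = \<ominus> (\<ominus> x)"
        using x by simp
      ultimately show ?thesis
        unfolding pm_unit_powers_def by blast
    qed
  qed
  then show ?thesis
    using sub neg by (auto simp: pm_unit_powers_def)
qed

text \<open>
  The element \<open>-1\<close> has order 2 in the unit group.
\<close>

lemma (in field) even_order_minus_one:
  assumes fin: "finite (carrier R)" and "\<one> \<oplus> \<one> \<noteq> \<zero>"
  shows "even (order R - 1)"
proof -
  interpret U: group "units_of R"
    by (rule units_group)
  have m1: "\<ominus> \<one> \<in> carrier (units_of R)"
    by (simp add: units_of_carrier Units_minus_one_closed)
  have "(\<ominus> \<one>) [^]\<^bsub>units_of R\<^esub> (2::nat) = \<one>\<^bsub>units_of R\<^esub>"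
    using minus_pow_even[of \<one> 2]
    by (simp add: units_of_pow units_of_one Units_minus_one_closed)
  then have "U.ord (\<ominus> \<one>) dvd 2"
    using U.pow_eq_id[OF m1, of 2] by simp
  moreover have "\<ominus> \<one> \<noteq> \<one>"
    using assms(2) by (metis one_closed r_neg)
  then have "U.ord (\<ominus> \<one>) \<noteq> 1"
    using U.ord_eq_1[OF m1] by (simp add: units_of_one)
  ultimately have "U.ord (\<ominus> \<one>) = 2"
    using two_is_prime_nat by (auto simp: prime_nat_iff)
  then show ?thesis
    using U.ord_dvd_group_order[OF m1] order_units_of[OF fin] by simp
qed

section \<open>Two-adic valuations\<close>

lemma even_div_gcd_if_multiplicity_less:
  fixes k n :: nat
  assumes "n > 0" "k > 0" "multiplicity 2 k < multiplicity 2 n"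
  shows "even (n div gcd k n)"
proof -
  define d where "d = n div gcd k n"
  have d: "n = gcd k n * d"
    by (simp add: d_def)
  then have "d > 0"
    using assms(1) by (cases d) auto
  have "multiplicity 2 (gcd k n) \<le> multiplicity 2 k"
    using assms by (intro dvd_imp_multiplicity_le) auto
  moreover have "multiplicity 2 n = multiplicity 2 (gcd k n) + multiplicity 2 d"
    using \<open>d > 0\<close> assms by (subst d, subst prime_elem_multiplicity_mult_distrib) auto
  ultimately have "multiplicity 2 d > 0"
    using assms(3) by simp
  then show ?thesis
    unfolding d_def by (metis not_dvd_imp_multiplicity_0 less_irrefl)
qed

text \<open>
  Write \<open>n = 2 ^ (a + 1) * n'\<close> and \<open>k = 2 ^ (a + 1 + c) * k'\<close> with \<open>n'\<close> and \<open>k'\<close> odd. Then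
  \<open>l = 2 ^ a * k'\<close>, and the gcds of \<open>k\<close> and \<open>l\<close> with \<open>n\<close> are \<open>gcd k' n'\<close> times \<open>2 ^ (a + 1)\<close> and
  \<open>2 ^ a\<close> respectively.
\<close>

lemma div_gcd_if_multiplicity_ge:
  fixes k n :: nat
  assumes n: "n > 0" "even n" and k: "k > 0" and ge: "multiplicity 2 k \<ge> multiplicity 2 n"
  defines "l \<equiv> k div 2 ^ (multiplicity 2 k - multiplicity 2 n + 1)"
  shows "l > 0" and "odd (n div gcd k n)" and "n div gcd l n = 2 * (n div gcd k n)"
proof -
  define a where "a = multiplicity 2 n - 1"
  define c where "c = multiplicity 2 k - multiplicity 2 n"
  obtain n' where n': "n = 2 ^ multiplicity 2 n * n'" "odd n'"
    using multiplicity_decompose'[of n 2] n by auto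
  obtain k' where k': "k = 2 ^ multiplicity 2 k * k'" "odd k'"
    using multiplicity_decompose'[of k 2] k by auto
  have "multiplicity 2 n > 0"
    using n by (simp add: multiplicity_gt_zero_iff)
  then have mn: "multiplicity 2 n = Suc a" and mk: "multiplicity 2 k = Suc a + c"
    using ge by (auto simp: a_def c_def)
  have neq: "n = 2 ^ Suc a * n'" and keq: "k = 2 ^ Suc a * (2 ^ c * k')"
    using n'(1) k'(1) by (simp_all add: mn mk power_add mult_ac)
  have leq: "l = 2 ^ a * k'"
    unfolding l_def c_def[symmetric] by (subst keq) (simp add: power_add)
  then show "l > 0"
    using k'(2) by (auto intro: Nat.gr0I)
  have gcd_k: "gcd k n = 2 ^ Suc a * gcd k' n'"
  proof -
    have "gcd (2 ^ c * k') n' = gcd k' n'"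
      using n'(2) by (intro gcd_mult_left_left_cancel) (simp add: coprime_commute)
    then show ?thesis
      by (simp only: neq keq gcd_mult_distrib_nat[symmetric])
  qed
  have gcd_l: "gcd l n = 2 ^ a * gcd k' n'"
  proof -
    have "gcd l n = 2 ^ a * gcd k' (2 * n')"
      by (simp add: neq leq gcd_mult_distrib_nat mult_ac)
    also have "gcd k' (2 * n') = gcd k' n'"
      using k'(2) by (intro gcd_mult_right_left_cancel) simp
    finally show ?thesis .
  qed
  obtain e where e: "n' = gcd k' n' * e"
    by (meson dvdE gcd_dvd2)
  have pos: "gcd k' n' > 0"
    using n'(2) by (auto intro: Nat.gr0I)
  have dk: "n div gcd k n = e"
    unfolding gcd_k using pos e neq by (metis nonzero_mult_div_cancel_left mult.assoc mult_eq_0_iff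
        less_irrefl power_not_zero zero_neq_numeral)
  have dl: "n div gcd l n = 2 * e"
  proof -
    have "n = (2 ^ a * gcd k' n') * (2 * e)"
      by (subst neq, subst e) simp
    then show ?thesis
      unfolding gcd_l using pos by (metis nonzero_mult_div_cancel_left mult_eq_0_iff
          less_irrefl power_not_zero zero_neq_numeral)
  qed
  show "odd (n div gcd k n)"
    using dk e n'(2) by (metis even_mult_iff)
  show "n div gcd l n = 2 * (n div gcd k n)"
    by (simp add: dk dl)
qed

section \<open>Reduction modulo the maximal ideal\<close>

text \<open>
  A non-unit generates a proper ideal. In a finite ring this lies in a maximal ideal, of which \<open>M\<close> is
  the only one.
\<close>

lemma (in local_ring) Units_if_not_in_maximalideal:
  assumes fin: "finite (carrier R)" and x: "x \<in> carrier R" "x \<notin> M"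
  shows "x \<in> Units R"
proof (rule ccontr)
  assume nu: "x \<notin> Units R"
  define \<I> where "\<I> = {I. ideal I R \<and> I \<noteq> carrier R}"
  have "\<I> \<subseteq> Pow (carrier R)"
    using ideal.Icarr by (fastforce simp: \<I>_def)
  then have "finite \<I>"
    using fin by (metis finite_Pow_iff finite_subset)
  moreover have "PIdl x \<in> \<I>"
  proof -
    have "PIdl x \<noteq> carrier R"
    proof
      assume "PIdl x = carrier R"
      then obtain y where "y \<in> carrier R" "\<one> = y \<otimes> x"
        using one_closed unfolding cgenideal_def by blast
      then show False
        using nu x(1) m_comm by (auto simp: Units_def)
    qed
    then show ?thesis
      using cgenideal_ideal[OF x(1)] by (simp add: \<I>_def)
  qed
  ultimately obtain J where J: "J \<in> \<I>" "PIdl x \<subseteq> J" "\<forall>I \<in> \<I>. J \<subseteq> I \<longrightarrow> J = I"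
    using finite_has_maximal2[of \<I> "PIdl x"] by metis
  have "maximalideal J R"
    using J by (intro maximalidealI) (auto simp: \<I>_def)
  then have "J = M"
    by (rule maximalideal_unique)
  then show False
    using J(2) x cgenideal_self[OF x(1)] by auto
qed

text \<open>
  Reduction modulo \<open>M\<close>, described by its kernel and image instead of by cosets, so that \<open>F\<close> can be any
  copy of the residue field.
\<close>

locale finite_local_residue_map = ring_hom_cring R F h + local_ring M R
  for R :: "('a, 'c) ring_scheme" (structure) and F :: "('b, 'd) ring_scheme" (structure)
    and h :: "'a \<Rightarrow> 'b" and M :: "'a set" +
  assumes finite_carrier: "finite (carrier R)"
    and field_F: "field F"
    and surj: "h ` carrier R = carrier F"
    and kernel: "\<And>x. x \<in> carrier R \<Longrightarrow> h x = \<zero>\<^bsub>F\<^esub> \<longleftrightarrow> x \<in> M"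
begin

lemma finite_carrier_F: "finite (carrier F)"
  using finite_carrier surj by (metis finite_imageI)

text \<open>
  Units of \<open>R\<close> can be recognised after reduction because everything outside \<open>M\<close> is invertible.
\<close>

lemma Units_iff:
  assumes x: "x \<in> carrier R"
  shows "x \<in> Units R \<longleftrightarrow> h x \<in> Units F"
proof
  assume "x \<in> Units R"
  then obtain y where "y \<in> carrier R" "y \<otimes> x = \<one>" "x \<otimes> y = \<one>"
    by (auto simp: Units_def)
  then show "h x \<in> Units F"
    using x unfolding Units_def by (auto intro!: bexI[of _ "h y"] simp flip: hom_mult)
next
  assume "h x \<in> Units F"
  then have "x \<notin> M"
    using field.field_Units[OF field_F] kernel[OF x] by simp
  then show "x \<in> Units R"
    using Units_if_not_in_maximalideal finite_carrier x by blast
qed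

lemma card_fibre:
  assumes "y \<in> carrier F"
  shows "card {x \<in> carrier R. h x = y} = card M"
proof -
  obtain x0 where x0: "x0 \<in> carrier R" "h x0 = y"
    using assms unfolding surj[symmetric] by blast
  have "bij_betw (\<lambda>z. z \<oplus> x0) M {x \<in> carrier R. h x = y}"
  proof (rule bij_betw_byWitness[where f' = "\<lambda>x. x \<ominus> x0"])
    show "\<forall>z\<in>M. z \<oplus> x0 \<ominus> x0 = z"
      using x0(1) Icarr by (auto simp: a_minus_def R.a_assoc R.r_neg)
    show "\<forall>x\<in>{x \<in> carrier R. h x = y}. x \<ominus> x0 \<oplus> x0 = x"
      using x0(1) by (auto simp: a_minus_def R.a_assoc R.l_neg)
    show "(\<lambda>z. z \<oplus> x0) ` M \<subseteq> {x \<in> carrier R. h x = y}"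
      using x0 Icarr kernel assms by auto
    show "(\<lambda>x. x \<ominus> x0) ` {x \<in> carrier R. h x = y} \<subseteq> M"
      using x0 assms by (auto simp: a_minus_def S.r_neg simp flip: kernel)
  qed
  then show ?thesis
    by (simp add: bij_betw_same_card)
qed

lemma card_preimage:
  assumes "T \<subseteq> carrier F"
  shows "card {x \<in> carrier R. h x \<in> T} = card M * card T"
proof -
  have "{x \<in> carrier R. h x \<in> T} = (\<Union>y\<in>T. {x \<in> carrier R. h x = y})"
    by auto
  moreover have "card (\<Union>y\<in>T. {x \<in> carrier R. h x = y}) = (\<Sum>y\<in>T. card {x \<in> carrier R. h x = y})"
    using finite_carrier finite_subset[OF assms finite_carrier_F]
    by (intro card_UN_disjoint) auto
  moreover have "\<dots> = (\<Sum>y\<in>T. card M)"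
    using assms by (intro sum.cong) (auto simp: card_fibre)
  ultimately show ?thesis
    by simp
qed

text \<open>
  The fibre over \<open>1\<close> is a subgroup of the unit group with as many elements as \<open>M\<close>, so this is
  Lagrange's theorem.
\<close>

lemma one_unit_pow_card_ideal:
  assumes "u \<in> carrier R" "h u = \<one>\<^bsub>F\<^esub>"
  shows "u [^] card M = \<one>"
proof -
  define V where "V = {x \<in> carrier R. h x = \<one>\<^bsub>F\<^esub>}"
  interpret U: group "units_of R"
    by (rule R.units_group)
  have VU: "V \<subseteq> Units R"
    using Units_iff by (auto simp: V_def)
  have "subgroup V (units_of R)"
  proof (rule U.subgroupI)
    show "V \<subseteq> carrier (units_of R)"
      using VU by (simp add: units_of_carrier)
    show "V \<noteq> {}"
      by (auto simp: V_def)
    show "inv\<^bsub>units_of R\<^esub> x \<in> V" if "x \<in> V" for x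
    proof -
      have x: "x \<in> Units R" "x \<in> carrier R" "h x = \<one>\<^bsub>F\<^esub>"
        using that VU by (auto simp: V_def)
      then have "h (inv x) = h x \<otimes>\<^bsub>F\<^esub> h (inv x)"
        by simp
      also have "\<dots> = h (x \<otimes> inv x)"
        using x by (simp del: R.Units_r_inv)
      also have "\<dots> = \<one>\<^bsub>F\<^esub>"
        using x by simp
      finally show ?thesis
        using x by (simp add: V_def R.units_of_inv)
    qed
    show "x \<otimes>\<^bsub>units_of R\<^esub> y \<in> V" if "x \<in> V" "y \<in> V" for x y
      using that by (auto simp: V_def units_of_mult)
  qed
  then interpret V: group "(units_of R)\<lparr>carrier := V\<rparr>"
    by (rule U.subgroup_imp_group)
  have "order ((units_of R)\<lparr>carrier := V\<rparr>) = card M"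
    by (simp add: order_def V_def card_fibre)
  moreover have "u \<in> V"
    using assms by (simp add: V_def)
  ultimately have "u [^]\<^bsub>(units_of R)\<lparr>carrier := V\<rparr>\<^esub> card M = \<one>"
    using V.pow_order_eq_1[of u] by (simp add: units_of_one)
  then show ?thesis
    using \<open>u \<in> V\<close> VU by (metis U.nat_pow_consistent R.units_of_pow subsetD)
qed

lemma coprime_card_ideal:
  assumes "coprime k (order R)"
  shows "coprime k (card M)"
proof -
  have "card M dvd order R"
    using R.a_lagrange[OF finite_carrier is_additive_subgroup] by (metis dvd_triv_right)
  then show ?thesis
    using assms coprime_divisors dvd_refl by blast
qed

text \<open>
  Lifting a power from \<open>F\<close>: if \<open>h x = h (y ^ k)\<close>, then \<open>u = x * y ^ (-k)\<close> lies over \<open>1\<close>. Its order divides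
  \<open>card M\<close>, which is prime to \<open>k\<close>, so \<open>u\<close> itself is a \<open>k\<close>-th power.
\<close>

lemma unit_powers_iff:
  assumes k: "k > 0" "coprime k (order R)" and x: "x \<in> carrier R"
  shows "x \<in> unit_powers R k \<longleftrightarrow> h x \<in> unit_powers F k"
proof
  assume "x \<in> unit_powers R k"
  then obtain y where "y \<in> Units R" "x = y [^] k"
    by (auto simp: unit_powers_def)
  then show "h x \<in> unit_powers F k"
    using Units_iff[of y] R.Units_closed[of y] unfolding unit_powers_def
    by (auto simp: hom_nat_pow)
next
  assume "h x \<in> unit_powers F k"
  then obtain y' where "y' \<in> Units F" "h x = y' [^]\<^bsub>F\<^esub> k"
    by (auto simp: unit_powers_def)
  moreover from this(1) obtain y where "y \<in> carrier R" "y' = h y"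
    using S.Units_closed unfolding surj[symmetric] by blast
  ultimately have y: "y \<in> carrier R" "y \<in> Units R" "h x = h (y [^] k)"
    using Units_iff by (auto simp: hom_nat_pow)
  define u where "u = x \<otimes> inv (y [^] k)"
  have yk: "y [^] k \<in> Units R"
    using y(2) by (rule R.Units_pow_closed)
  have u: "u \<in> carrier R" "x = u \<otimes> y [^] k"
    using x y yk by (simp_all add: u_def R.m_assoc)
  have "h u = h (y [^] k \<otimes> inv (y [^] k))"
    using x y yk by (simp add: u_def del: R.Units_r_inv)
  then have hu: "h u = \<one>\<^bsub>F\<^esub>"
    using yk by simp
  obtain a b where ab: "k * a = card M * b + 1"
    using bezout_nat[of k "card M"] coprime_card_ideal[OF k(2)] k(1) by auto
  have "(u [^] a) [^] k = u [^] (card M * b + 1)"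
    using u(1) by (simp only: R.nat_pow_pow mult.commute[of a] ab)
  also have "\<dots> = u"
    using u(1) one_unit_pow_card_ideal[OF u(1) hu]
    by (simp flip: R.nat_pow_mult R.nat_pow_pow)
  finally have "x = (u [^] a \<otimes> y) [^] k"
    using u y by (simp add: R.nat_pow_distrib)
  moreover have "u \<in> Units R"
    using Units_iff[OF u(1)] hu by simp
  then have "u [^] a \<otimes> y \<in> Units R"
    using y(2) R.Units_pow_closed R.Units_m_closed by blast
  ultimately show "x \<in> unit_powers R k"
    by (auto simp: unit_powers_def)
qed

lemma pm_unit_powers_iff:
  assumes k: "k > 0" "coprime k (order R)" and x: "x \<in> carrier R"
  shows "x \<in> pm_unit_powers R k \<longleftrightarrow> h x \<in> pm_unit_powers F k"
proof -
  have hx: "h x \<in> carrier F"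
    using x by simp
  show ?thesis
    unfolding R.mem_pm_unit_powers_iff[OF x] S.mem_pm_unit_powers_iff[OF hx]
    using unit_powers_iff[OF k, of x] unit_powers_iff[OF k, of "\<ominus> x"] x by simp
qed

lemma cayley_digraph_preimage_iso:
  assumes "\<And>x. x \<in> carrier R \<Longrightarrow> x \<in> S \<longleftrightarrow> h x \<in> T"
  shows "digraph_iso (with_proj (cayley_digraph R S))
    (with_proj (balanced_blow_up (cayley_digraph F T) (card M)))"
proof (rule digraph_iso_balanced_blow_upI[where f = h])
  fix v w
  have "w \<ominus> v \<in> S \<longleftrightarrow> h w \<ominus>\<^bsub>F\<^esub> h v \<in> T" if "v \<in> carrier R" "w \<in> carrier R"
    using assms[of "w \<ominus> v"] that by (simp add: a_minus_def)
  then show "(v, w) \<in> parcs (cayley_digraph R S) \<longleftrightarrow> v \<in> pverts (cayley_digraph R S) \<and>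
      w \<in> pverts (cayley_digraph R S) \<and> (h v, h w) \<in> parcs (cayley_digraph F T)"
    by (auto simp: cayley_digraph_def)
qed (use finite_carrier surj card_fibre in \<open>auto simp: cayley_digraph_def\<close>)

lemma pm_unit_power_graph_iso:
  assumes "k > 0" "coprime k (order R)"
  shows "digraph_iso (with_proj (pm_unit_power_graph R k))
    (with_proj (balanced_blow_up (pm_unit_power_graph F k) (card M)))"
  unfolding pm_unit_power_graph_def
  using pm_unit_powers_iff[OF assms] by (rule cayley_digraph_preimage_iso)

lemma pm_unit_power_graph_regular:
  assumes "k > 0" "coprime k (order R)"
  shows "regular_digraph (with_proj (pm_unit_power_graph R k)) (card M * card (pm_unit_powers F k))"
proof -
  have sub: "pm_unit_powers R k \<subseteq> carrier R" "pm_unit_powers F k \<subseteq> carrier F"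
    by (auto simp: pm_unit_powers_def unit_powers_def)
  then have "pm_unit_powers R k = {x \<in> carrier R. h x \<in> pm_unit_powers F k}"
    using pm_unit_powers_iff[OF assms] by auto
  then show ?thesis
    using R.regular_cayley_digraph[OF sub(1)] card_preimage[OF sub(2)]
    by (simp add: pm_unit_power_graph_def)
qed

text \<open>
  The additive order of \<open>1\<close> in \<open>F\<close> divides the odd characteristic of \<open>R\<close>; if \<open>1 + 1 = 0\<close> it would also
  divide 2, which forces \<open>1 = 0\<close>.
\<close>

lemma two_nonzero_if_odd_characteristic:
  assumes "odd (ring_characteristic R)"
  shows "\<one>\<^bsub>F\<^esub> \<oplus>\<^bsub>F\<^esub> \<one>\<^bsub>F\<^esub> \<noteq> \<zero>\<^bsub>F\<^esub>"
proof
  assume two: "\<one>\<^bsub>F\<^esub> \<oplus>\<^bsub>F\<^esub> \<one>\<^bsub>F\<^esub> = \<zero>\<^bsub>F\<^esub>"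
  interpret A: group_hom "add_monoid R" "add_monoid F" h
    by (rule group_hom.intro[OF R.a_group S.a_group])
      (auto simp: group_hom_axioms_def intro!: homI)
  let ?c = "ring_characteristic R"
  have "\<one> [^]\<^bsub>add_monoid R\<^esub> ?c = \<zero>"
    using group.pow_ord_eq_1[OF R.a_group, of \<one>] by (simp add: ring_characteristic_def)
  then have "\<one>\<^bsub>F\<^esub> [^]\<^bsub>add_monoid F\<^esub> ?c = \<zero>\<^bsub>F\<^esub>"
    using A.hom_nat_pow[of \<one> ?c] by simp
  then have "group.ord (add_monoid F) \<one>\<^bsub>F\<^esub> dvd ?c"
    using group.pow_eq_id[OF S.a_group, of "\<one>\<^bsub>F\<^esub>" ?c] by simp
  moreover have "\<one>\<^bsub>F\<^esub> [^]\<^bsub>add_monoid F\<^esub> (2::nat) = \<zero>\<^bsub>F\<^esub>"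
    using two by (simp add: numeral_2_eq_2)
  then have "group.ord (add_monoid F) \<one>\<^bsub>F\<^esub> dvd 2"
    using group.pow_eq_id[OF S.a_group, of "\<one>\<^bsub>F\<^esub>" 2] by simp
  ultimately have "group.ord (add_monoid F) \<one>\<^bsub>F\<^esub> dvd gcd ?c 2"
    by simp
  moreover have "gcd ?c 2 = 1"
    using assms by (simp add: coprime_iff_gcd_eq_1[symmetric])
  ultimately have "group.ord (add_monoid F) \<one>\<^bsub>F\<^esub> = 1"
    by simp
  then have "\<one>\<^bsub>F\<^esub> = \<zero>\<^bsub>F\<^esub>"
    using group.ord_eq_1[OF S.a_group, of "\<one>\<^bsub>F\<^esub>"] by simp
  then show False
    using domain.one_not_zero[OF field.axioms(1)[OF field_F]] by simp
qed

end

lemma (in local_ring) residue_mapE: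
  assumes "finite (carrier R)" and F: "field F" and iso: "R Quot M \<simeq> F"
  obtains h where "finite_local_residue_map R F h M"
proof -
  obtain g where g: "g \<in> ring_hom (R Quot M) F" "bij_betw g (carrier (R Quot M)) (carrier F)"
    using iso unfolding is_ring_iso_def ring_iso_def by blast
  interpret F: field F by (rule F)
  interpret Q: ring "R Quot M" by (rule quotient_is_ring)
  interpret g: ring_hom_ring "R Quot M" F g
    using g(1) by unfold_locales
  define h where "h = (\<lambda>x. g (M +> x))"
  have "h \<in> ring_hom R F"
    using ring_hom_trans[OF rcos_ring_hom g(1)] by (simp add: h_def comp_def)
  then interpret ring_hom_cring R F h
    by unfold_locales
  have Q: "carrier (R Quot M) = (\<lambda>x. M +> x) ` carrier R"
    by (auto simp: FactRing_def A_RCOSETS_def')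
  have "finite_local_residue_map R F h M"
  proof unfold_locales
    show "h ` carrier R = carrier F"
      using bij_betw_imp_surj_on[OF g(2)] by (simp add: Q h_def image_image)
    fix x assume x: "x \<in> carrier R"
    have zero: "\<zero>\<^bsub>R Quot M\<^esub> = M"
      by (simp add: FactRing_def)
    have "h x = \<zero>\<^bsub>F\<^esub> \<longleftrightarrow> g (M +> x) = g \<zero>\<^bsub>R Quot M\<^esub>"
      by (simp add: h_def)
    also have "\<dots> \<longleftrightarrow> M +> x = \<zero>\<^bsub>R Quot M\<^esub>"
      using inj_on_eq_iff[OF bij_betw_imp_inj_on[OF g(2)]] x Q Q.zero_closed by blast
    also have "\<dots> \<longleftrightarrow> x \<in> M"
      using zero x a_rcos_self a_rcos_const by metis
    finally show "h x = \<zero>\<^bsub>F\<^esub> \<longleftrightarrow> x \<in> M" .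
  qed (use assms in auto)
  then show ?thesis
    by (rule that)
qed

theorem theorem5p7:
  fixes R :: "('a, 'c) ring_scheme" and F :: "('b, 'd) ring_scheme"
    and M :: "'a set" and k m q :: nat
  assumes "local_ring M R" and "finite (carrier R)" and "card M = m"
    and "field F" and "finite (carrier F)" and "order F = q" and "R Quot M \<simeq> F"
    and "k > 0" and "gcd k (order R) = 1"
  shows
    "digraph_iso (with_proj (pm_unit_power_graph R k))
       (with_proj (balanced_blow_up (pm_unit_power_graph F k) m)) \<and>
     (odd (ring_characteristic R) \<longrightarrow>
        (multiplicity 2 k < multiplicity 2 (q - 1) \<longrightarrow>
           digraph_iso (with_proj (pm_unit_power_graph R k))
             (with_proj (balanced_blow_up (unit_power_digraph F k) m))) \<and>
        (multiplicity 2 k \<ge> multiplicity 2 (q - 1) \<longrightarrow>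
           (let N = multiplicity 2 k - multiplicity 2 (q - 1) + 1 in
            digraph_iso (with_proj (pm_unit_power_graph R k))
              (with_proj (balanced_blow_up (unit_power_digraph F (k div 2 ^ N)) m)))) \<and>
        (let k' = gcd k (q - 1) in
           (multiplicity 2 k < multiplicity 2 (q - 1) \<longrightarrow>
              regular_digraph (with_proj (pm_unit_power_graph R k)) ((m * (q - 1)) div k')) \<and>
           (multiplicity 2 k \<ge> multiplicity 2 (q - 1) \<longrightarrow>
              regular_digraph (with_proj (pm_unit_power_graph R k)) ((2 * m * (q - 1)) div k'))))"
proof -
  interpret L: local_ring M R by (rule assms(1))
  interpret F: field F by (rule assms(4))
  obtain h where "finite_local_residue_map R F h M"
    using L.residue_mapE[OF assms(2,4,7)] by blast
  then interpret h: finite_local_residue_map R F h M .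
  have k: "k > 0" "coprime k (order R)"
    using assms(8,9) by (simp_all add: coprime_iff_gcd_eq_1)
  define n where "n = order F - 1"
  have n: "q - 1 = n"
    using assms(6) by (simp add: n_def)
  note iso = h.pm_unit_power_graph_iso[OF k, unfolded assms(3)]
  note regular = h.pm_unit_power_graph_regular[OF k, unfolded assms(3)]
  have iso_unit: "digraph_iso (with_proj (pm_unit_power_graph R k))
      (with_proj (balanced_blow_up (unit_power_digraph F l) m))"
    if "pm_unit_powers F k = unit_powers F l" for l
    using iso that by (simp add: pm_unit_power_graph_def unit_power_digraph_def)
  have n_pos: "n > 0"
    using F.order_units_of[OF assms(5)] F.field_Units assms(5)
      monoid.order_gt_0_iff_finite[OF group.is_monoid[OF F.units_group]]
    by (simp add: n_def units_of_carrier)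
  have less: "pm_unit_powers F k = unit_powers F k \<and>
      m * card (pm_unit_powers F k) = (m * n) div gcd k n"
    if "multiplicity 2 k < multiplicity 2 n"
  proof -
    have "pm_unit_powers F k = unit_powers F k"
      using F.pm_unit_powers_eq_if_even[OF assms(5) k(1)]
        even_div_gcd_if_multiplicity_less[OF n_pos k(1) that] by (simp add: n_def)
    then show ?thesis
      using F.unit_powers_finite_field(2)[OF assms(5) k(1)] by (simp add: n_def div_mult_swap)
  qed
  have ge: "pm_unit_powers F k = unit_powers F (k div 2 ^ (multiplicity 2 k - multiplicity 2 n + 1)) \<and>
      m * card (pm_unit_powers F k) = (2 * m * n) div gcd k n"
    if odd: "odd (ring_characteristic R)" and ge: "multiplicity 2 n \<le> multiplicity 2 k"
  proof -
    define l where "l = k div 2 ^ (multiplicity 2 k - multiplicity 2 n + 1)"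
    have "even n"
      using F.even_order_minus_one[OF assms(5) h.two_nonzero_if_odd_characteristic[OF odd]]
      by (simp add: n_def)
    note l = div_gcd_if_multiplicity_ge[OF n_pos this k(1) ge, folded l_def]
    have eq: "pm_unit_powers F k = unit_powers F l"
      using F.pm_unit_powers_eq_if_odd[OF assms(5) k(1) l(1)] l(2,3) by (simp add: n_def)
    then have "m * card (pm_unit_powers F k) = m * (2 * (n div gcd k n))"
      using F.unit_powers_finite_field(2)[OF assms(5) l(1)] l(3) by (simp add: n_def)
    also have "\<dots> = (2 * m * n) div gcd k n"
      by (simp add: div_mult_swap mult_ac)
    finally show ?thesis
      using eq by (simp add: l_def)
  qed
  show ?thesis
    unfolding n Let_def
    using iso iso_unit regular less ge by metis
qed

end
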